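(* Let $\mu$ and $\nu$ be partitions of $n$. Then $\mu$ and $\nu$ are rook equivalent if and only if $\mu$ and $\nu$ are Wilf equivalent.
   Context: A partition is an infinite weakly decreasing sequence $\mu_1\ge\mu_2\ge\cdots$ of nonnegative integers with finitely many nonzero terms; it is identified with its Ferrers board (row $i$ has $\mu_i$ boxes, left-justified, rows numbered from the top). Two partitions are rook equivalent if, for every $k\ge 0$, the number of ways to place $k$ non-attacking rooks (no two in the same row or column) on the Ferrers board of one equals that number for the other. A partition $\alpha$ contains a partition $\mu$ (as a pattern) if the Ferrers board of $\mu$ can be obtained from that of $\alpha$ by deleting some rows and some columns. Let $\mathcal{P}_N(\mu)$ be the set of partitions of $N$ containing $\mu$. Partitions $\mu,\nu$ are Wilf equivalent if $|\mathcal{P}_N(\mu)|=|\mathcal{P}_N(\nu)|$ for every integer $N\ge 1$. *)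

theory Defs
  imports Main
begin

text \<open>
  A partition is the sequence of its parts. Rows and columns are numbered from \<open>0\<close>, so
  \<open>\<mu> i\<close> is the part usually written \<open>\<mu>\<close> with index \<open>i + 1\<close>.
\<close>

definition is_partition :: "(nat \<Rightarrow> nat) \<Rightarrow> bool" where
  "is_partition \<mu> \<longleftrightarrow> antimono \<mu> \<and> finite {i. \<mu> i \<noteq> 0}"

definition partition_of :: "(nat \<Rightarrow> nat) \<Rightarrow> nat \<Rightarrow> bool" where
  "partition_of \<mu> n \<longleftrightarrow> is_partition \<mu> \<and> (\<Sum>i | \<mu> i \<noteq> 0. \<mu> i) = n"

definition ferrers_board :: "(nat \<Rightarrow> nat) \<Rightarrow> (nat \<times> nat) set" where
  "ferrers_board \<mu> = {(i, j). j < \<mu> i}"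

definition rook_placements :: "(nat \<times> nat) set \<Rightarrow> nat \<Rightarrow> (nat \<times> nat) set set" where
  "rook_placements B k =
     {P. P \<subseteq> B \<and> finite P \<and> card P = k \<and>
         (\<forall>p\<in>P. \<forall>q\<in>P. p \<noteq> q \<longrightarrow> fst p \<noteq> fst q \<and> snd p \<noteq> snd q)}"

definition rook_number :: "(nat \<times> nat) set \<Rightarrow> nat \<Rightarrow> nat" where
  "rook_number B k = card (rook_placements B k)"

definition rook_equivalent :: "(nat \<Rightarrow> nat) \<Rightarrow> (nat \<Rightarrow> nat) \<Rightarrow> bool" where
  "rook_equivalent \<mu> \<nu> \<longleftrightarrow>
     (\<forall>k. rook_number (ferrers_board \<mu>) k = rook_number (ferrers_board \<nu>) k)"

text \<open>
  Delete the rows in \<open>R\<close> and the columns in \<open>C\<close> and close the gaps: a surviving row \<open>i\<close> gets as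
  its new number the number of surviving rows above it, and similarly for columns.
\<close>

definition delete_rows_cols ::
    "nat set \<Rightarrow> nat set \<Rightarrow> (nat \<times> nat) set \<Rightarrow> (nat \<times> nat) set" where
  "delete_rows_cols R C B =
     (\<lambda>(i, j). (card ({..<i} - R), card ({..<j} - C))) ` {(i, j) \<in> B. i \<notin> R \<and> j \<notin> C}"

definition contains_pattern :: "(nat \<Rightarrow> nat) \<Rightarrow> (nat \<Rightarrow> nat) \<Rightarrow> bool" where
  "contains_pattern \<alpha> \<mu> \<longleftrightarrow>
     (\<exists>R C. delete_rows_cols R C (ferrers_board \<alpha>) = ferrers_board \<mu>)"

definition partitions_containing :: "nat \<Rightarrow> (nat \<Rightarrow> nat) \<Rightarrow> (nat \<Rightarrow> nat) set" where
  "partitions_containing N \<mu> = {\<alpha>. partition_of \<alpha> N \<and> contains_pattern \<alpha> \<mu>}"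

definition wilf_equivalent :: "(nat \<Rightarrow> nat) \<Rightarrow> (nat \<Rightarrow> nat) \<Rightarrow> bool" where
  "wilf_equivalent \<mu> \<nu> \<longleftrightarrow>
     (\<forall>N\<ge>1. card (partitions_containing N \<mu>) = card (partitions_containing N \<nu>))"

text \<open>The sets counted above are finite, so \<open>card\<close> is their true cardinality.\<close>

lemma partition_of_bounds:
  assumes "partition_of \<alpha> N"
  shows "\<alpha> i \<le> N" and "N \<le> i \<Longrightarrow> \<alpha> i = 0"
proof -
  have anti: "antimono \<alpha>" and fin: "finite {i. \<alpha> i \<noteq> 0}"
    and sum: "(\<Sum>i | \<alpha> i \<noteq> 0. \<alpha> i) = N"
    using assms by (auto simp: partition_of_def is_partition_def)
  show "\<alpha> i \<le> N"
  proof (cases "\<alpha> i = 0")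
    case False
    then have "\<alpha> i \<le> (\<Sum>i | \<alpha> i \<noteq> 0. \<alpha> i)"
      using fin by (intro member_le_sum) auto
    then show ?thesis using sum by simp
  qed simp
  show "\<alpha> i = 0" if "N \<le> i"
  proof (rule ccontr)
    assume nz: "\<alpha> i \<noteq> 0"
    have sub: "{..i} \<subseteq> {i. \<alpha> i \<noteq> 0}"
    proof
      fix j assume "j \<in> {..i}"
      then have "\<alpha> i \<le> \<alpha> j" using anti by (auto dest: antimonoD)
      then show "j \<in> {i. \<alpha> i \<noteq> 0}" using nz by simp
    qed
    have "Suc i \<le> card {i. \<alpha> i \<noteq> 0}" using card_mono[OF fin sub] by simp
    also have "\<dots> = (\<Sum>i | \<alpha> i \<noteq> 0. 1)" by simp
    also have "\<dots> \<le> (\<Sum>i | \<alpha> i \<noteq> 0. \<alpha> i)" by (rule sum_mono) simp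
    finally show False using sum that by simp
  qed
qed

lemma finite_partitions_containing: "finite (partitions_containing N \<mu>)"
proof (rule finite_subset)
  show "partitions_containing N \<mu> \<subseteq>
      {f. \<forall>i. (i \<in> {..<N} \<longrightarrow> f i \<in> {..N}) \<and> (i \<notin> {..<N} \<longrightarrow> f i = 0)}"
    using partition_of_bounds by (auto simp: partitions_containing_def)
  show "finite {f. \<forall>i::nat. (i \<in> {..<N} \<longrightarrow> f i \<in> {..N}) \<and> (i \<notin> {..<N} \<longrightarrow> f i = 0)}"
    by (rule finite_set_of_finite_funs) auto
qed

lemma finite_ferrers_board:
  assumes "is_partition \<mu>"
  shows "finite (ferrers_board \<mu>)"
proof -
  have "ferrers_board \<mu> = Sigma {i. \<mu> i \<noteq> 0} (\<lambda>i. {..<\<mu> i})"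
    by (auto simp: ferrers_board_def)
  then show ?thesis using assms by (simp add: is_partition_def)
qed

lemma finite_rook_placements: "finite B \<Longrightarrow> finite (rook_placements B k)"
  by (rule finite_subset[of _ "Pow B"]) (auto simp: rook_placements_def)

end

theory Submission
  imports
    Defs
    "HOL-Computational_Algebra.Formal_Power_Series"
    "HOL-Computational_Algebra.Polynomial"
    "HOL-Library.Multiset"
    "HOL-Library.Sublist"
begin

text \<open>
  Both equivalences are shown to hold iff the multisets of the numbers \<open>\<mu> i + i\<close>, \<open>i < n\<close>, agree.

  For rook numbers this is the factorization
  \<open>\<Sum>t\<le>n. r t * x * (x - 1) * \<dots> * (x - (n - t) + 1) = \<Prod>i<n. (x - n + 1 + \<mu> i + i)\<close>.

  A partition contains \<open>\<mu>\<close> iff it has \<open>l\<close> rows (\<open>l\<close> being the number of nonzero parts of \<open>\<mu>\<close>) whose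
  excesses over the parts of \<open>\<mu>\<close> are nonnegative and weakly decreasing from top to bottom. Choosing
  these rows greedily from the bottom makes the generating function satisfy a first-order recursion
  in the lower bound for the parts, solved by
  \<open>\<Sum>j. (- 1) ^ j * q ^ (n + j * (j + 1) div 2) * h j / ((1 - q) * \<dots> * (1 - q ^ (n + j)))\<close>
  times the generating function of all partitions, where \<open>h j\<close> is the complete symmetric polynomial
  of degree \<open>j\<close> in the variables \<open>q ^ (\<mu> i + i)\<close>. It depends only on the multiset; conversely, if
  \<open>\<beta>\<close> is the least number whose multiplicities in two such multisets differ, then the two sums
  differ in the coefficient of \<open>q ^ (n + 1 + \<beta>)\<close>, to which among the differences only the summand
  \<open>j = 1\<close> contributes.
\<close>

text \<open>For a partition of \<open>n\<close> it is used with \<open>k = n\<close>. Zero rows are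
  included, so that partitions with different numbers of nonzero parts become comparable.\<close>

definition row_shifts :: "(nat \<Rightarrow> nat) \<Rightarrow> nat \<Rightarrow> nat multiset" where
  "row_shifts \<mu> k = image_mset (\<lambda>i. \<mu> i + i) (mset_set {..<k})"

lemma row_shifts_0 [simp]: "row_shifts \<mu> 0 = {#}"
  by (simp add: row_shifts_def)

lemma row_shifts_Suc: "row_shifts \<mu> (Suc k) = add_mset (\<mu> k + k) (row_shifts \<mu> k)"
  by (simp add: row_shifts_def lessThan_Suc)

section \<open>Rook numbers\<close>

text \<open>The rows of a partition are restored from the bottom up, so that each new row is at
  least as long as all rows already present.\<close>

definition lower_board :: "(nat \<Rightarrow> nat) \<Rightarrow> nat \<Rightarrow> (nat \<times> nat) set" where
  "lower_board \<mu> k = {(i, j). k \<le> i \<and> j < \<mu> i}"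

lemma finite_lower_board:
  assumes "is_partition \<mu>"
  shows "finite (lower_board \<mu> k)"
  by (rule finite_subset[OF _ finite_ferrers_board[OF assms]])
    (auto simp: lower_board_def ferrers_board_def)

lemma card_cols_rook_placement:
  assumes "P \<in> rook_placements B t"
  shows "card (snd ` P) = t"
proof -
  have "inj_on snd P" using assms by (auto simp: rook_placements_def inj_on_def)
  then show ?thesis using assms by (simp add: card_image rook_placements_def)
qed

lemma cols_lower_board:
  assumes "antimono \<mu>" "P \<in> rook_placements (lower_board \<mu> (Suc k)) t"
  shows "snd ` P \<subseteq> {..<\<mu> k}"
proof
  fix j assume "j \<in> snd ` P"
  then obtain i where "(i, j) \<in> P" by auto
  then have "k \<le> i" "j < \<mu> i" using assms(2) by (auto simp: rook_placements_def lower_board_def)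
  then show "j \<in> {..<\<mu> k}" using antimonoD[OF assms(1), of k i] by simp
qed

text \<open>Case split on whether row \<open>k\<close> holds a rook; if so, its column must avoid
  those of the other \<open>t\<close> rooks.\<close>

lemma rook_placements_lower_board_Suc:
  assumes "antimono \<mu>"
  shows "rook_placements (lower_board \<mu> k) (Suc t) =
    rook_placements (lower_board \<mu> (Suc k)) (Suc t) \<union>
    (\<lambda>(P, j). insert (k, j) P) `
      (SIGMA P : rook_placements (lower_board \<mu> (Suc k)) t. {..<\<mu> k} - snd ` P)"
    (is "?L = ?A \<union> ?B")
proof
  show "?A \<union> ?B \<subseteq> ?L"
  proof
    fix Q assume "Q \<in> ?A \<union> ?B"
    then show "Q \<in> ?L"
    proof
      assume "Q \<in> ?A"
      moreover have "lower_board \<mu> (Suc k) \<subseteq> lower_board \<mu> k" by (auto simp: lower_board_def)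
      ultimately show ?thesis by (auto simp: rook_placements_def)
    next
      assume "Q \<in> ?B"
      then obtain P j where Q: "Q = insert (k, j) P" and j: "j < \<mu> k" "j \<notin> snd ` P"
        and P: "P \<in> rook_placements (lower_board \<mu> (Suc k)) t" by auto
      have "k < fst p" if "p \<in> P" for p
        using P that by (auto simp: rook_placements_def lower_board_def)
      then have row: "k \<notin> fst ` P" by auto
      then have "(k, j) \<notin> P" by force
      then show ?thesis
        using P j row unfolding Q by (auto simp: rook_placements_def lower_board_def image_iff)
    qed
  qed
  show "?L \<subseteq> ?A \<union> ?B"
  proof
    fix Q assume Q: "Q \<in> ?L"
    then have sub: "Q \<subseteq> lower_board \<mu> k" and fin: "finite Q" and card: "card Q = Suc t"
      and att: "\<And>p q. p \<in> Q \<Longrightarrow> q \<in> Q \<Longrightarrow> p \<noteq> q \<Longrightarrow> fst p \<noteq> fst q \<and> snd p \<noteq> snd q"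
      by (auto simp: rook_placements_def)
    show "Q \<in> ?A \<union> ?B"
    proof (cases "k \<in> fst ` Q")
      case False
      have "Q \<subseteq> lower_board \<mu> (Suc k)"
      proof
        fix p assume p: "p \<in> Q"
        then have "fst p \<noteq> k" using False by auto
        then show "p \<in> lower_board \<mu> (Suc k)" using p sub by (auto simp: lower_board_def)
      qed
      then show ?thesis using Q by (auto simp: rook_placements_def)
    next
      case True
      then obtain j where j: "(k, j) \<in> Q" by auto
      define P where "P = Q - {(k, j)}"
      have Q_eq: "Q = insert (k, j) P" using j by (auto simp: P_def)
      have "P \<subseteq> lower_board \<mu> (Suc k)"
      proof
        fix p assume p: "p \<in> P"
        then have "fst p \<noteq> k" using att[of p "(k, j)"] j by (auto simp: P_def)
        then show "p \<in> lower_board \<mu> (Suc k)"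
          using p sub by (auto simp: lower_board_def P_def)
      qed
      then have "P \<in> rook_placements (lower_board \<mu> (Suc k)) t"
        using fin card j att by (auto simp: rook_placements_def P_def)
      moreover have "j < \<mu> k" using j sub by (auto simp: lower_board_def)
      moreover have "j \<notin> snd ` P"
      proof
        assume "j \<in> snd ` P"
        then obtain p where "p \<in> Q" "p \<noteq> (k, j)" "snd p = j" by (auto simp: P_def)
        then show False using att[of p "(k, j)"] j by auto
      qed
      ultimately have "(P, j) \<in> (SIGMA P : rook_placements (lower_board \<mu> (Suc k)) t. {..<\<mu> k} - snd ` P)"
        by auto
      then have "Q \<in> ?B" unfolding Q_eq by (rule rev_image_eqI) simp
      then show ?thesis ..
    qed
  qed
qed

text \<open>By \<open>cols_lower_board\<close>, a placement of \<open>t\<close> rooks below blocks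
  exactly \<open>t\<close> of the \<open>\<mu> k\<close> cells of row \<open>k\<close>. If
  \<open>t\<close> exceeds \<open>\<mu> k\<close>, the negative factor is multiplied by 0.\<close>

lemma rook_number_lower_board_Suc:
  assumes part: "is_partition \<mu>"
  shows "int (rook_number (lower_board \<mu> k) (Suc t)) =
    int (rook_number (lower_board \<mu> (Suc k)) (Suc t)) +
    (int (\<mu> k) - int t) * int (rook_number (lower_board \<mu> (Suc k)) t)"
proof -
  have anti: "antimono \<mu>" using part by (simp add: is_partition_def)
  let ?R = "\<lambda>t. rook_placements (lower_board \<mu> (Suc k)) t"
  let ?S = "SIGMA P : ?R t. {..<\<mu> k} - snd ` P"
  let ?f = "\<lambda>(P, j). insert (k, j) P"
  have fin: "finite (?R t)" for t
    by (intro finite_rook_placements finite_lower_board part)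
  have row: "(k, j) \<notin> P" if "P \<in> ?R t" for P j t
    using that by (auto simp: rook_placements_def lower_board_def)
  have inj: "inj_on ?f ?S"
  proof (rule inj_onI)
    fix p q assume "p \<in> ?S" "q \<in> ?S" "?f p = ?f q"
    moreover obtain P j P' j' where "p = (P, j)" "q = (P', j')" by fastforce
    ultimately show "p = q" using row[of P t] row[of P' t] by (auto simp: insert_eq_iff split: if_splits)
  qed
  have disj: "?R (Suc t) \<inter> ?f ` ?S = {}" using row[of _ "Suc t"] by auto
  have "rook_number (lower_board \<mu> k) (Suc t) = rook_number (lower_board \<mu> (Suc k)) (Suc t) + card ?S"
    unfolding rook_number_def
    by (subst rook_placements_lower_board_Suc[OF anti], subst card_Un_disjoint)
      (use fin disj inj in \<open>auto simp: card_image\<close>)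
  moreover have "int (card ?S) = (int (\<mu> k) - int t) * int (card (?R t))"
  proof -
    have "int (card ?S) = (\<Sum>P\<in>?R t. int (card ({..<\<mu> k} - snd ` P)))"
      using fin by (simp add: card_SigmaI)
    also have "\<dots> = (\<Sum>P\<in>?R t. int (\<mu> k) - int t)"
    proof (rule sum.cong[OF refl])
      fix P assume P: "P \<in> ?R t"
      have "int (card ({..<\<mu> k} - snd ` P)) = int (card {..<\<mu> k}) - int (card (snd ` P))"
        using cols_lower_board[OF anti P]
        by (subst card_Diff_subset) (auto simp: of_nat_diff card_mono finite_subset
            dest: card_mono[rotated])
      then show "int (card ({..<\<mu> k} - snd ` P)) = int (\<mu> k) - int t"
        using card_cols_rook_placement[OF P] by simp
    qed
    finally show ?thesis by simp
  qed
  ultimately show ?thesis by (simp add: rook_number_def)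
qed

lemma rook_number_0 [simp]: "rook_number B 0 = 1"
proof -
  have "rook_placements B 0 = {{}}" by (auto simp: rook_placements_def)
  then show ?thesis by (simp add: rook_number_def)
qed

lemma rook_number_eq_0:
  assumes "fst ` B \<subseteq> {k..<n}" "n - k < t"
  shows "rook_number B t = 0"
proof -
  have "rook_placements B t = {}"
  proof (rule ccontr)
    assume "rook_placements B t \<noteq> {}"
    then obtain P where P: "P \<in> rook_placements B t" by auto
    then have "inj_on fst P" by (auto simp: rook_placements_def inj_on_def)
    then have "card P = card (fst ` P)" by (simp add: card_image)
    also have "\<dots> \<le> card {k..<n}"
      by (rule card_mono) (use P assms(1) in \<open>auto simp: rook_placements_def\<close>)
    finally show False using P assms(2) by (simp add: rook_placements_def)
  qed
  then show ?thesis by (simp add: rook_number_def)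
qed

definition falling :: "int \<Rightarrow> nat \<Rightarrow> int" where
  "falling x p = (\<Prod>i<p. x - int i)"

text \<open>Goldman, Joichi and White's factorization, adding the rows from the shortest to the longest.\<close>

lemma rook_factorization_lower_board:
  assumes part: "is_partition \<mu>" and zero: "\<And>i. n \<le> i \<Longrightarrow> \<mu> i = 0" and "m \<le> n"
  shows "(\<Sum>t\<le>m. int (rook_number (lower_board \<mu> (n - m)) t) * falling x (m - t)) =
    (\<Prod>i\<in>{n - m..<n}. x + int (\<mu> i + i) - int n + 1)"
  using \<open>m \<le> n\<close>
proof (induction m)
  case 0
  then show ?case by (simp add: falling_def)
next
  case (Suc m)
  define k where "k = n - Suc m"
  have nm: "n - m = Suc k" "k < n" "n = k + Suc m" using Suc.prems by (auto simp: k_def)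
  let ?r = "\<lambda>t. int (rook_number (lower_board \<mu> k) t)"
  let ?r' = "\<lambda>t. int (rook_number (lower_board \<mu> (Suc k)) t)"
  have "fst ` lower_board \<mu> (Suc k) \<subseteq> {Suc k..<n}"
    using zero by (force simp: lower_board_def not_le[symmetric])
  \<comment> \<open>At most \<open>m\<close> rows below row \<open>k\<close> are nonempty, so the
    term \<open>t = Suc m\<close> can be added or dropped freely.\<close>
  then have r'0: "?r' (Suc m) = 0"
    using rook_number_eq_0[of "lower_board \<mu> (Suc k)" "Suc k" n "Suc m"] nm by simp
  have top: "x + int (\<mu> k + k) - int n + 1 = x + int (\<mu> k) - int m" using nm(3) by simp
  have ff: "falling x (Suc m - t) = falling x (m - t) * (x - int m + int t)" if "t \<le> m" for t
    using that by (simp add: Suc_diff_le falling_def of_nat_diff)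
  have "(\<Sum>t\<le>Suc m. ?r t * falling x (Suc m - t)) =
      falling x (Suc m) + (\<Sum>t\<le>m. ?r (Suc t) * falling x (m - t))"
    by (simp add: sum.atMost_Suc_shift del: sum.atMost_Suc)
  also have "\<dots> = falling x (Suc m) + (\<Sum>t\<le>m. ?r' (Suc t) * falling x (m - t)) +
      (\<Sum>t\<le>m. (int (\<mu> k) - int t) * ?r' t * falling x (m - t))"
    by (simp add: rook_number_lower_board_Suc[OF part, of k] distrib_right sum.distrib)
  also have "falling x (Suc m) + (\<Sum>t\<le>m. ?r' (Suc t) * falling x (m - t)) =
      (\<Sum>t\<le>Suc m. ?r' t * falling x (Suc m - t))"
    by (simp add: sum.atMost_Suc_shift del: sum.atMost_Suc)
  also have "\<dots> = (\<Sum>t\<le>m. ?r' t * falling x (Suc m - t))" by (simp add: r'0)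
  \<comment> \<open>The factor \<open>x - m + t\<close> split off by \<open>ff\<close> and the
    number \<open>\<mu> k - t\<close> of free cells add up to \<open>x + \<mu> k - m\<close>, free
    of \<open>t\<close>.\<close>
  also have "\<dots> + (\<Sum>t\<le>m. (int (\<mu> k) - int t) * ?r' t * falling x (m - t)) =
      (\<Sum>t\<le>m. (x + int (\<mu> k) - int m) * (?r' t * falling x (m - t)))"
    unfolding sum.distrib[symmetric] by (rule sum.cong) (auto simp: ff algebra_simps)
  also have "\<dots> = (x + int (\<mu> k) - int m) * (\<Sum>t\<le>m. ?r' t * falling x (m - t))"
    by (rule sum_distrib_left[symmetric])
  also have "\<dots> = (x + int (\<mu> k) - int m) * (\<Prod>i\<in>{Suc k..<n}. x + int (\<mu> i + i) - int n + 1)"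
    using Suc.IH Suc.prems nm(1) by simp
  also have "\<dots> = (\<Prod>i\<in>{k..<n}. x + int (\<mu> i + i) - int n + 1)"
    unfolding prod.atLeast_Suc_lessThan[OF nm(2)] top ..
  finally show ?case by (simp only: k_def)
qed

lemma rook_factorization:
  assumes \<mu>: "partition_of \<mu> n"
  shows "(\<Sum>t\<le>n. int (rook_number (ferrers_board \<mu>) t) * falling x (n - t)) =
    (\<Prod>e\<in>#row_shifts \<mu> n. x - int n + 1 + int e)"
proof -
  have "ferrers_board \<mu> = lower_board \<mu> 0" by (simp add: ferrers_board_def lower_board_def)
  moreover have "(\<Prod>e\<in>#row_shifts \<mu> n. x - int n + 1 + int e) =
      (\<Prod>i\<in>{0..<n}. x + int (\<mu> i + i) - int n + 1)"
    by (simp add: row_shifts_def prod_unfold_prod_mset image_mset.compositionality comp_def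
        atLeast0LessThan algebra_simps)
  ultimately show ?thesis
    using rook_factorization_lower_board[of \<mu> n n x] partition_of_bounds(2)[OF \<mu>] \<mu>
    by (simp add: partition_of_def)
qed

section \<open>Rook numbers and the multiset of shifts determine each other\<close>

text \<open>Evaluating at \<open>x = p\<close> kills the falling factorials of length above
  \<open>p\<close>, so the equations are triangular; induction on \<open>p = n - t\<close> isolates
  one coefficient at a time.\<close>

lemma falling_coeffs_unique:
  fixes a b :: "nat \<Rightarrow> int"
  assumes eq: "\<And>x. (\<Sum>t\<le>n. a t * falling x (n - t)) = (\<Sum>t\<le>n. b t * falling x (n - t))"
    and "t \<le> n"
  shows "a t = b t"
proof -
  have "p \<le> n \<longrightarrow> a (n - p) = b (n - p)" for p
  proof (induction p rule: less_induct)
    case (less p)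
    show ?case
    proof
      assume p: "p \<le> n"
      have "0 = (\<Sum>t\<le>n. (a t - b t) * falling (int p) (n - t))"
        using eq[of "int p"] by (simp add: left_diff_distrib sum_subtractf)
      also have "\<dots> = (\<Sum>t\<in>{n - p}. (a t - b t) * falling (int p) (n - t))"
      proof (rule sum.mono_neutral_right)
        show "\<forall>t\<in>{..n} - {n - p}. (a t - b t) * falling (int p) (n - t) = 0"
        proof
          fix t assume t: "t \<in> {..n} - {n - p}"
          show "(a t - b t) * falling (int p) (n - t) = 0"
          proof (cases "n - t < p")
            case True
            then show ?thesis using less[of "n - t"] t by simp
          next
            case False
            then have "p < n - t" using t p by auto
            then have "falling (int p) (n - t) = 0" by (auto simp: falling_def)
            then show ?thesis by simp
          qed
        qed
      qed auto
      also have "\<dots> = (a (n - p) - b (n - p)) * falling (int p) p" using p by simp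
      finally have "(a (n - p) - b (n - p)) * falling (int p) p = 0" by simp
      moreover have "falling (int p) p \<noteq> 0" by (auto simp: falling_def)
      ultimately show "a (n - p) = b (n - p)" by simp
    qed
  qed
  from this[of "n - t"] show ?thesis using \<open>t \<le> n\<close> by simp
qed

text \<open>Both products are polynomials agreeing at every integer, hence equal; their roots with
  multiplicity are the negated entries.\<close>

lemma prod_linear_inj:
  assumes "\<And>x :: int. (\<Prod>e\<in>#A. x + int e) = (\<Prod>e\<in>#B. x + int e)"
  shows "A = B"
proof -
  define P where "P C = (\<Prod>e\<in>#C. [:int e, 1:])" for C
  have poly: "poly (P C) x = (\<Prod>e\<in>#C. x + int e)" for C x
    by (induction C) (auto simp: P_def algebra_simps)
  have roots: "proots (P C) = image_mset (\<lambda>e. - int e) C" for C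
  proof (induction C)
    case (add e C)
    have "P C \<noteq> 0" by (auto simp: P_def prod_mset_zero_iff)
    then show ?case using add by (simp add: P_def proots_mult del: mult_pCons_left)
  qed (simp add: P_def)
  have "P A = P B" using assms by (auto simp: poly simp flip: poly_eq_poly_eq_iff)
  then have "image_mset (\<lambda>e. - int e) A = image_mset (\<lambda>e. - int e) B" by (metis roots)
  then have "image_mset (\<lambda>z. nat (- z)) (image_mset (\<lambda>e. - int e) A) =
      image_mset (\<lambda>z. nat (- z)) (image_mset (\<lambda>e. - int e) B)" by simp
  then show ?thesis by (simp add: image_mset.compositionality comp_def)
qed

lemma rook_equivalent_iff:
  assumes \<mu>: "partition_of \<mu> n" and \<nu>: "partition_of \<nu> n"
  shows "rook_equivalent \<mu> \<nu> \<longleftrightarrow> row_shifts \<mu> n = row_shifts \<nu> n"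
proof
  assume rook: "rook_equivalent \<mu> \<nu>"
  show "row_shifts \<mu> n = row_shifts \<nu> n"
  proof (rule prod_linear_inj)
    fix x :: int
    \<comment> \<open>Evaluating the factorization at \<open>x + n - 1\<close> cancels the constant
      \<open>- n + 1\<close> in every factor.\<close>
    show "(\<Prod>e\<in>#row_shifts \<mu> n. x + int e) = (\<Prod>e\<in>#row_shifts \<nu> n. x + int e)"
      using rook_factorization[OF \<mu>, of "x + int n - 1"] rook_factorization[OF \<nu>, of "x + int n - 1"]
        rook by (simp add: rook_equivalent_def)
  qed
next
  assume eq: "row_shifts \<mu> n = row_shifts \<nu> n"
  show "rook_equivalent \<mu> \<nu>"
    unfolding rook_equivalent_def
  proof
    fix t
    show "rook_number (ferrers_board \<mu>) t = rook_number (ferrers_board \<nu>) t"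
    proof (cases "t \<le> n")
      case True
      have "int (rook_number (ferrers_board \<mu>) t) = int (rook_number (ferrers_board \<nu>) t)"
        by (rule falling_coeffs_unique[OF _ True]) (simp add: rook_factorization[OF \<mu>] rook_factorization[OF \<nu>] eq)
      then show ?thesis by simp
    next
      case False
      \<comment> \<open>The factorization only sees \<open>t \<le> n\<close>; more than
        \<open>n\<close> rooks do not fit into \<open>n\<close> rows.\<close>
      have "rook_number (ferrers_board \<alpha>) t = 0" if "partition_of \<alpha> n" for \<alpha>
      proof (rule rook_number_eq_0)
        show "fst ` ferrers_board \<alpha> \<subseteq> {0..<n}"
          using partition_of_bounds(2)[OF that] by (force simp: ferrers_board_def not_le[symmetric])
      qed (use False in simp)
      then show ?thesis using \<mu> \<nu> by simp
    qed
  qed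
qed

section \<open>Pattern containment\<close>

text \<open>
  The parts \<open>xs\<close> are listed in increasing order, so the rows \<open>k - 1, \<dots>, 0\<close> of \<open>\<mu>\<close> are matched from
  the bottom up; \<open>s\<close> is the excess of the part matched last, a lower bound for the next one.
\<close>

fun greedy :: "(nat \<Rightarrow> nat) \<Rightarrow> nat \<Rightarrow> nat \<Rightarrow> nat list \<Rightarrow> bool" where
  "greedy \<mu> s 0 xs = True"
| "greedy \<mu> s (Suc k) [] = False"
| "greedy \<mu> s (Suc k) (x # xs) =
    (if \<mu> k + s \<le> x then greedy \<mu> (x - \<mu> k) k xs else greedy \<mu> s (Suc k) xs)"

text \<open>Unlike \<open>greedy\<close>, nothing is skipped: \<open>ys\<close> is the exact list of
  selected parts, a witness for the success of the search.\<close>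

fun chain :: "(nat \<Rightarrow> nat) \<Rightarrow> nat \<Rightarrow> nat \<Rightarrow> nat list \<Rightarrow> bool" where
  "chain \<mu> s 0 ys = (ys = [])"
| "chain \<mu> s (Suc k) [] = False"
| "chain \<mu> s (Suc k) (y # ys) = (\<mu> k + s \<le> y \<and> chain \<mu> (y - \<mu> k) k ys)"

lemma chain_antimono: "chain \<mu> s k ys \<Longrightarrow> t \<le> s \<Longrightarrow> chain \<mu> t k ys"
  by (cases k; cases ys) auto

lemma chain_length: "chain \<mu> s k ys \<Longrightarrow> length ys = k"
  by (induction \<mu> s k ys rule: chain.induct) auto

lemma greedy_imp_chain: "greedy \<mu> s k xs \<Longrightarrow> \<exists>ys. subseq ys xs \<and> chain \<mu> s k ys"
proof (induction \<mu> s k xs rule: greedy.induct)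
  case (3 \<mu> s k x xs)
  show ?case
  proof (cases "\<mu> k + s \<le> x")
    case True
    with 3 obtain ys where "subseq ys xs" "chain \<mu> (x - \<mu> k) k ys" by auto
    with True have "subseq (x # ys) (x # xs) \<and> chain \<mu> s (Suc k) (x # ys)" by simp
    then show ?thesis by blast
  next
    case False
    with 3 show ?thesis by auto
  qed
qed auto

text \<open>Exchange argument: in a sorted list an admissible head \<open>x\<close> is at most the
  part \<open>y\<close> chosen by the chain. Taking \<open>x\<close> leaves a weaker bound, and the
  rest of the chain survives by \<open>chain_antimono\<close>.\<close>

lemma chain_imp_greedy:
  "sorted xs \<Longrightarrow> subseq ys xs \<Longrightarrow> chain \<mu> s k ys \<Longrightarrow> greedy \<mu> s k xs"
proof (induction \<mu> s k xs arbitrary: ys rule: greedy.induct)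
  case (2 \<mu> s k)
  then show ?case by (cases ys) auto
next
  case (3 \<mu> s k x xs)
  from 3(5) obtain y ys' where ys: "ys = y # ys'"
    and y: "\<mu> k + s \<le> y" and c: "chain \<mu> (y - \<mu> k) k ys'"
    by (cases ys) auto
  have sub: "subseq ys' xs" using 3(4) ys
    by (cases "y = x") (auto dest: subseq_Cons')
  obtain N where N: "ys = nths (x # xs) N" using 3(4) unfolding subseq_conv_nths by blast
  have "y \<in> set (x # xs)" by (rule in_set_nthsD[of _ _ N]) (simp flip: N add: ys)
  then have xy: "x \<le> y" using 3(3) by auto
  show ?case
  proof (cases "\<mu> k + s \<le> x")
    case True
    have "chain \<mu> (x - \<mu> k) k ys'" by (rule chain_antimono[OF c]) (use xy in simp)
    then show ?thesis using 3(1)[OF True _ sub] 3(3) True by simp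
  next
    case False
    then have "x \<noteq> y" using y by auto
    then have "subseq ys xs" using 3(4) ys by auto
    then show ?thesis using 3(2)[OF False _ _ 3(5)] 3(3) False by simp
  qed
qed auto

text \<open>The list is reversed because row \<open>k - 1\<close> is matched first. A chain compares
  neighbouring excesses, the right-hand side all pairs. Truncated subtraction is harmless, as the
  first conjunct gives \<open>\<mu> i \<le> \<rho> i\<close>.\<close>

lemma chain_rev_map_iff:
  "chain \<mu> s k (rev (map \<rho> [0..<k])) \<longleftrightarrow>
     (\<forall>i<k. \<mu> i + s \<le> \<rho> i) \<and> (\<forall>i j. i \<le> j \<longrightarrow> j < k \<longrightarrow> \<rho> j - \<mu> j \<le> \<rho> i - \<mu> i)"
proof (induction k arbitrary: s)
  case (Suc k)
  show ?case
  proof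
    assume "chain \<mu> s (Suc k) (rev (map \<rho> [0..<Suc k]))"
    then have 1: "\<mu> k + s \<le> \<rho> k" and 2: "chain \<mu> (\<rho> k - \<mu> k) k (rev (map \<rho> [0..<k]))"
      by auto
    show "(\<forall>i<Suc k. \<mu> i + s \<le> \<rho> i) \<and>
        (\<forall>i j. i \<le> j \<longrightarrow> j < Suc k \<longrightarrow> \<rho> j - \<mu> j \<le> \<rho> i - \<mu> i)"
    proof (intro conjI allI impI)
      have 3: "\<mu> i \<le> \<rho> i" "\<rho> k - \<mu> k \<le> \<rho> i - \<mu> i" if "i < k" for i
      proof -
        have "\<mu> i + (\<rho> k - \<mu> k) \<le> \<rho> i" using 2 that unfolding Suc.IH by blast
        then show "\<mu> i \<le> \<rho> i" "\<rho> k - \<mu> k \<le> \<rho> i - \<mu> i" by simp_all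
      qed
      show "\<mu> i + s \<le> \<rho> i" if "i < Suc k" for i
        using 1 3[of i] that by (cases "i = k") auto
      show "\<rho> j - \<mu> j \<le> \<rho> i - \<mu> i" if "i \<le> j" "j < Suc k" for i j
        using 2 3[of i] that unfolding Suc.IH by (cases "i = k"; cases "j = k") auto
    qed
  next
    assume *: "(\<forall>i<Suc k. \<mu> i + s \<le> \<rho> i) \<and>
        (\<forall>i j. i \<le> j \<longrightarrow> j < Suc k \<longrightarrow> \<rho> j - \<mu> j \<le> \<rho> i - \<mu> i)"
    have "\<mu> i + (\<rho> k - \<mu> k) \<le> \<rho> i" if "i < k" for i
    proof -
      have "\<rho> k - \<mu> k \<le> \<rho> i - \<mu> i" "\<mu> i \<le> \<rho> i"
        using * that by (simp, metis add_leD1 less_Suc_eq)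
      then show ?thesis by simp
    qed
    then have "chain \<mu> (\<rho> k - \<mu> k) k (rev (map \<rho> [0..<k]))"
      unfolding Suc.IH using * by auto
    then show "chain \<mu> s (Suc k) (rev (map \<rho> [0..<Suc k]))" using * by simp
  qed
qed simp

lemma subseq_rev: "subseq xs ys \<Longrightarrow> subseq (rev xs) (rev ys)"
  by (induction rule: list_emb.induct) (auto intro: subseq_rev_drop_many list_emb_append_mono)

lemma strict_mono_on_imp_subseq:
  fixes r :: "nat \<Rightarrow> nat"
  assumes "strict_mono_on {..<k} r" "\<And>i. i < k \<Longrightarrow> r i < p"
  shows "subseq (map r [0..<k]) [0..<p]"
proof (rule sorted_subset_imp_subseq)
  show "set (map r [0..<k]) \<subseteq> set [0..<p]" using assms(2) by auto
  show "sorted_wrt (<) (map r [0..<k])"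
    using assms(1) by (auto simp: sorted_wrt_iff_nth_less strict_mono_on_def)
qed simp

lemma greedy_iff_rows:
  assumes anti: "antimono \<alpha>" and p: "\<And>i. \<alpha> i \<noteq> 0 \<longleftrightarrow> i < p" and l: "\<And>i. i < l \<Longrightarrow> \<mu> i \<noteq> 0"
  shows "greedy \<mu> 0 l (rev (map \<alpha> [0..<p])) \<longleftrightarrow>
    (\<exists>r. strict_mono_on {..<l} r \<and> (\<forall>i<l. \<mu> i \<le> \<alpha> (r i)) \<and>
      (\<forall>i j. i \<le> j \<longrightarrow> j < l \<longrightarrow> \<alpha> (r j) - \<mu> j \<le> \<alpha> (r i) - \<mu> i))"
    (is "?L \<longleftrightarrow> (\<exists>r. ?R r)")
proof
  assume ?L
  then obtain ys where ys: "subseq ys (rev (map \<alpha> [0..<p]))" "chain \<mu> 0 l ys"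
    using greedy_imp_chain by blast
  \<comment> \<open>Parts may repeat, so the selection of values is lifted by positions to a list
    \<open>us\<close> of row indices.\<close>
  then obtain N where "ys = nths (rev (map \<alpha> [0..<p])) N" by (auto simp: subseq_conv_nths)
  then have "ys = map \<alpha> (nths (rev [0..<p]) N)" by (simp add: rev_map nths_map)
  then obtain us where us: "ys = map \<alpha> us" "subseq us (rev [0..<p])"
    using subseq_conv_nths by blast
  define zs where "zs = rev us"
  have "sorted_wrt (>) us"
  proof -
    obtain N where "us = nths (rev [0..<p]) N" using us(2) by (auto simp: subseq_conv_nths)
    moreover have "sorted_wrt (>) (nths xs N)" if "sorted_wrt (>) xs" for xs :: "nat list"
      using that by (induction xs arbitrary: N) (auto simp: nths_Cons dest: in_set_nthsD)
    ultimately show ?thesis by (simp add: sorted_wrt_rev)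
  qed
  then have zs: "sorted_wrt (<) zs" by (simp add: zs_def sorted_wrt_rev)
  have len: "length zs = l" using chain_length[OF ys(2)] us by (simp add: zs_def)
  let ?r = "\<lambda>i. zs ! i"
  have "ys = rev (map \<alpha> zs)" by (simp add: us zs_def rev_map)
  also have "map \<alpha> zs = map (\<lambda>i. \<alpha> (?r i)) [0..<l]"
    by (simp add: list_eq_iff_nth_eq len)
  finally have "chain \<mu> 0 l (rev (map (\<lambda>i. \<alpha> (?r i)) [0..<l]))" using ys(2) by simp
  then have "?R ?r" unfolding chain_rev_map_iff using zs len
    by (auto simp: strict_mono_on_def sorted_wrt_nth_less)
  then show "\<exists>r. ?R r" by blast
next
  assume "\<exists>r. ?R r"
  then obtain r where r: "?R r" by blast
  \<comment> \<open>The chosen rows have parts at least \<open>\<mu> i > 0\<close>, so they are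
    among the listed nonzero rows.\<close>
  have "r i < p" if "i < l" for i
    using r l[OF that] that p[of "r i"] by (metis le_zero_eq)
  then have "subseq (map \<alpha> (map r [0..<l])) (map \<alpha> [0..<p])"
    using r by (intro subseq_map strict_mono_on_imp_subseq) auto
  then have sub: "subseq (rev (map (\<lambda>i. \<alpha> (r i)) [0..<l])) (rev (map \<alpha> [0..<p]))"
    by (simp add: comp_def subseq_rev)
  have "sorted (rev (map \<alpha> [0..<p]))"
    using anti by (simp only: sorted_wrt_rev, simp add: sorted_wrt_map sorted_wrt_iff_nth_less antimono_def)
  then show ?L
    by (rule chain_imp_greedy[OF _ sub]) (use r in \<open>simp add: chain_rev_map_iff\<close>)
qed

section \<open>Deleting rows and columns of a Ferrers board\<close>

text \<open>\<open>D\<close> will be the set of kept columns. It is built from the bottom row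
  upwards: row \<open>k\<close> needs \<open>b k - b (k + 1)\<close> columns more than row
  \<open>k + 1\<close>, and since the excess \<open>a - b\<close> does not decrease going up, row
  \<open>k\<close> is long enough to hold them.\<close>

lemma columns_with_prescribed_counts:
  fixes a b :: "nat \<Rightarrow> nat"
  assumes "antimono b" "\<And>i. i < l \<Longrightarrow> b i \<le> a i"
    and "\<And>i j. i \<le> j \<Longrightarrow> j < l \<Longrightarrow> a j - b j \<le> a i - b i"
  shows "\<exists>D. \<forall>i<l. card ({..<a i} \<inter> D) = b i"
proof -
  have "\<exists>D. \<forall>i. k \<le> i \<longrightarrow> i < l \<longrightarrow> card ({..<a i} \<inter> D) = b i" if "k \<le> l" for k
    using that
  proof (induction "l - k" arbitrary: k)
    case 0
    then show ?case by auto
  next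
    case (Suc d)
    then have kl: "k < l" by simp
    obtain D where D: "\<And>i. Suc k \<le> i \<Longrightarrow> i < l \<Longrightarrow> card ({..<a i} \<inter> D) = b i"
      using Suc(1)[of "Suc k"] Suc(2) kl
      by (metis Suc_diff_Suc Suc_leI diff_Suc_1 nat.inject)
    have anti_a: "a j \<le> a i" if "i \<le> j" "j < l" for i j
    proof -
      have "b j \<le> b i" using assms(1) that by (auto dest: antimonoD)
      moreover have "b i \<le> a i" "b j \<le> a j" "a j - b j \<le> a i - b i"
        using assms(2)[of i] assms(2)[of j] assms(3)[of i j] that by auto
      ultimately show ?thesis by linarith
    qed
    \<comment> \<open>A virtual row of length and count 0 below the last row starts the
      construction.\<close>
    define u where "u = (if Suc k < l then a (Suc k) else 0)"
    define v where "v = (if Suc k < l then b (Suc k) else 0)"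
    \<comment> \<open>Columns of \<open>D\<close> from \<open>u\<close> on are discarded, and the
      missing ones are taken immediately to the right of row \<open>k + 1\<close>, where they do not
      meet the rows below.\<close>
    define E where "E = ({..<u} \<inter> D) \<union> {u..<u + (b k - v)}"
    have ub: "v \<le> b k" "u + (b k - v) \<le> a k"
      using assms(1) assms(2)[of k] assms(2)[of "Suc k"] assms(3)[of k "Suc k"] anti_a[of k "Suc k"] kl
      by (auto simp: u_def v_def antimono_def le_Suc_eq)
    have ED: "card ({..<a i} \<inter> E) = b i" if "Suc k \<le> i" "i < l" for i
    proof -
      have "a i \<le> u" using anti_a[of "Suc k" i] that by (auto simp: u_def)
      then have "{..<a i} \<inter> E = {..<a i} \<inter> D" by (auto simp: E_def)
      then show ?thesis using D that by simp
    qed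
    have "card ({..<u} \<inter> D) = v" using D[of "Suc k"] by (auto simp: u_def v_def)
    moreover have "{..<a k} \<inter> E = ({..<u} \<inter> D) \<union> {u..<u + (b k - v)}"
      using ub by (auto simp: E_def)
    moreover have "card (({..<u} \<inter> D) \<union> {u..<u + (b k - v)}) = card ({..<u} \<inter> D) + (b k - v)"
      by (subst card_Un_disjoint) auto
    ultimately have "card ({..<a k} \<inter> E) = b k" using ub by simp
    then have "\<forall>i. k \<le> i \<longrightarrow> i < l \<longrightarrow> card ({..<a i} \<inter> E) = b i"
      using ED by (metis Suc_leI le_neq_implies_less)
    then show ?case ..
  qed
  from this[of 0] show ?thesis by auto
qed

text \<open>Renumbering closes all gaps, so what survives of a row is again left-justified.\<close>

lemma image_card_lessThan:
  "(\<lambda>j. card ({..<j} - C)) ` ({..<a} - C) = {..<card ({..<a::nat} - C)}"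
proof (induction a)
  case (Suc a)
  show ?case
  proof (cases "a \<in> C")
    case True
    then have "{..<Suc a} - C = {..<a} - C" by (auto simp: lessThan_Suc)
    then show ?thesis using Suc by simp
  next
    case False
    then have "{..<Suc a} - C = insert a ({..<a} - C)" by (auto simp: lessThan_Suc)
    then show ?thesis using Suc by (simp add: lessThan_Suc)
  qed
qed simp

lemma mem_delete_rows_cols_ferrers_iff:
  "(p, q) \<in> delete_rows_cols R C (ferrers_board \<alpha>) \<longleftrightarrow>
     (\<exists>i. i \<notin> R \<and> p = card ({..<i} - R) \<and> q < card ({..<\<alpha> i} - C))"
proof -
  have "q < card ({..<\<alpha> i} - C) \<longleftrightarrow> (\<exists>j<\<alpha> i. j \<notin> C \<and> q = card ({..<j} - C))" for i
    using image_card_lessThan[of C "\<alpha> i"] by (auto simp: set_eq_iff image_iff)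
  then show ?thesis
    by (auto simp: delete_rows_cols_def ferrers_board_def image_iff)
qed

lemma card_lessThan_Diff_less:
  assumes "i \<notin> R" "i < (j::nat)"
  shows "card ({..<i} - R) < card ({..<j} - R)"
  by (rule psubset_card_mono) (use assms in auto)

text \<open>If \<open>r i\<close> is the surviving row that becomes row \<open>i\<close>, its excess
  over \<open>\<mu> i\<close> counts the deleted columns it meets, and a longer row meets at least
  as many. Conversely, \<open>columns_with_prescribed_counts\<close> yields the columns to
  keep.\<close>

lemma contains_pattern_iff_rows:
  assumes anti: "antimono \<alpha>" "antimono \<mu>" and l: "\<And>i. \<mu> i \<noteq> 0 \<longleftrightarrow> i < l"
  shows "contains_pattern \<alpha> \<mu> \<longleftrightarrow>
    (\<exists>r. strict_mono_on {..<l} r \<and> (\<forall>i<l. \<mu> i \<le> \<alpha> (r i)) \<and>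
      (\<forall>i j. i \<le> j \<longrightarrow> j < l \<longrightarrow> \<alpha> (r j) - \<mu> j \<le> \<alpha> (r i) - \<mu> i))"
    (is "?L \<longleftrightarrow> (\<exists>r. ?R r)")
proof
  assume ?L
  then obtain R C where RC: "delete_rows_cols R C (ferrers_board \<alpha>) = ferrers_board \<mu>"
    by (auto simp: contains_pattern_def)
  have mem: "q < \<mu> p \<longleftrightarrow> (\<exists>i. i \<notin> R \<and> p = card ({..<i} - R) \<and> q < card ({..<\<alpha> i} - C))" for p q
    using mem_delete_rows_cols_ferrers_iff[of p q R C \<alpha>] unfolding RC by (simp add: ferrers_board_def)
  have "\<exists>i. i \<notin> R \<and> p = card ({..<i} - R)" if "p < l" for p
    using mem[of 0 p] l[of p] that by auto
  then obtain r where r: "\<And>p. p < l \<Longrightarrow> r p \<notin> R" "\<And>p. p < l \<Longrightarrow> p = card ({..<r p} - R)"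
    by metis
  \<comment> \<open>Distinct surviving rows get distinct new numbers, so only \<open>r p\<close> can
    become row \<open>p\<close>.\<close>
  have inj: "i = r p" if "p < l" "i \<notin> R" "p = card ({..<i} - R)" for i p
    using card_lessThan_Diff_less[of i R "r p"] card_lessThan_Diff_less[of "r p" R i]
      r[OF that(1)] that by (metis linorder_neqE_nat less_irrefl_nat)
  have val: "\<mu> p = card ({..<\<alpha> (r p)} - C)" if "p < l" for p
  proof -
    have "q < \<mu> p \<longleftrightarrow> q < card ({..<\<alpha> (r p)} - C)" for q
      unfolding mem using inj[OF that] r[OF that] by metis
    then show ?thesis by (metis linorder_neqE_nat less_irrefl_nat)
  qed
  have mono: "r p < r q" if "p < q" "q < l" for p q
  proof (rule ccontr)
    assume "\<not> r p < r q"
    then have "card ({..<r q} - R) \<le> card ({..<r p} - R)" by (intro card_mono) auto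
    then show False using r(2)[of p] r(2)[of q] that by simp
  qed
  have gap: "\<alpha> (r p) - \<mu> p = card ({..<\<alpha> (r p)} \<inter> C)" if "p < l" for p
    using card_Int_Diff[of "{..<\<alpha> (r p)}" C] val[OF that] by simp
  have "?R r"
  proof (intro conjI allI impI)
    show "strict_mono_on {..<l} r" using mono by (auto simp: strict_mono_on_def)
    show "\<mu> i \<le> \<alpha> (r i)" if "i < l" for i
      using card_Int_Diff[of "{..<\<alpha> (r i)}" C] val[OF that] by simp
    fix i j assume ij: "i \<le> j" "j < l"
    then have "r i \<le> r j" using mono[of i j] by (cases "i = j") auto
    then have "\<alpha> (r j) \<le> \<alpha> (r i)" using anti by (auto dest: antimonoD)
    then have "card ({..<\<alpha> (r j)} \<inter> C) \<le> card ({..<\<alpha> (r i)} \<inter> C)" by (intro card_mono) auto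
    then show "\<alpha> (r j) - \<mu> j \<le> \<alpha> (r i) - \<mu> i" using gap ij by simp
  qed
  then show "\<exists>r. ?R r" by blast
next
  assume "\<exists>r. ?R r"
  then obtain r where r: "?R r" by blast
  obtain D where D: "\<And>i. i < l \<Longrightarrow> card ({..<\<alpha> (r i)} \<inter> D) = \<mu> i"
    using columns_with_prescribed_counts[OF anti(2), of l "\<lambda>i. \<alpha> (r i)"] r by auto
  define R C where "R = - r ` {..<l}" and "C = - D"
  have rc: "card ({..<r p} - R) = p" if "p < l" for p
  proof -
    have "i < p" if "i < l" "r i < r p" for i
      using r that \<open>p < l\<close> by (metis strict_mono_onD lessThan_iff linorder_neqE_nat less_asym less_irrefl_nat)
    moreover have "r i < r p" if "i < p" for i
      using r that \<open>p < l\<close> by (auto simp: strict_mono_on_def)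
    ultimately have "{..<r p} - R = r ` {..<p}" using that by (auto simp: R_def)
    moreover have "inj_on r {..<p}"
      using r that strict_mono_on_imp_inj_on[of "{..<l}" r] by (auto elim!: inj_on_subset)
    ultimately show ?thesis by (simp add: card_image)
  qed
  have "(p, q) \<in> delete_rows_cols R C (ferrers_board \<alpha>) \<longleftrightarrow> (p, q) \<in> ferrers_board \<mu>" for p q
  proof -
    have "(p, q) \<in> delete_rows_cols R C (ferrers_board \<alpha>) \<longleftrightarrow>
        (\<exists>i<l. p = card ({..<r i} - R) \<and> q < card ({..<\<alpha> (r i)} - C))"
      unfolding mem_delete_rows_cols_ferrers_iff by (auto simp: R_def)
    also have "\<dots> \<longleftrightarrow> (\<exists>i<l. p = i \<and> q < \<mu> i)"
      using rc D by (auto simp: C_def Diff_Compl)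
    also have "\<dots> \<longleftrightarrow> (p, q) \<in> ferrers_board \<mu>"
      using l[of p] by (auto simp: ferrers_board_def)
    finally show ?thesis .
  qed
  then have "delete_rows_cols R C (ferrers_board \<alpha>) = ferrers_board \<mu>" by auto
  then show ?L by (auto simp: contains_pattern_def)
qed

section \<open>The series attached to a multiset of shifted rows\<close>

unbundle fps_syntax

text \<open>The geometric series \<open>1 / (1 - q ^ e * z)\<close>: the outer variable
  \<open>z\<close> marks the degree, the inner variable is \<open>q\<close>.\<close>

definition geo :: "nat \<Rightarrow> rat fps fps" where
  "geo e = Abs_fps (\<lambda>j. fps_X ^ (e * j))"

text \<open>The coefficient of \<open>z ^ j\<close> is the complete homogeneous symmetric polynomial
  at the values \<open>q ^ e\<close>.\<close>

definition complete_sym :: "nat multiset \<Rightarrow> nat \<Rightarrow> rat fps" where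
  "complete_sym A j = (\<Prod>e\<in>#A. geo e) $ j"

definition qfact :: "nat \<Rightarrow> rat fps" where
  "qfact k = (\<Prod>i<k. 1 - fps_X ^ Suc i)"

text \<open>Stopping at \<open>j = N\<close> gives the true infinite sum as soon as
  \<open>q ^ j\<close> divides every \<open>t j\<close>.\<close>

definition fps_infsum :: "(nat \<Rightarrow> rat fps) \<Rightarrow> rat fps" where
  "fps_infsum t = Abs_fps (\<lambda>N. \<Sum>j\<le>N. t j $ N)"

text \<open>Here \<open>\<Sum>{..j}\<close> is \<open>j * (j + 1) div 2\<close>. The parameter
  \<open>s\<close> is the lower bound for excesses on which the recursion runs; the final series has
  \<open>s = 0\<close>.\<close>

definition rook_term :: "nat \<Rightarrow> nat \<Rightarrow> nat multiset \<Rightarrow> nat \<Rightarrow> nat \<Rightarrow> rat fps" where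
  "rook_term n k A s j =
     (- 1) ^ j * fps_X ^ (n + \<Sum>{..j} + s * (k + j)) * complete_sym A j * inverse (qfact (k + j))"

definition rook_series :: "nat \<Rightarrow> nat \<Rightarrow> nat multiset \<Rightarrow> nat \<Rightarrow> rat fps" where
  "rook_series n k A s = fps_infsum (rook_term n k A s)"

lemma geo_eq: "geo e = 1 + fps_const (fps_X ^ e) * fps_X * geo e"
proof (rule fps_ext)
  fix j show "geo e $ j = (1 + fps_const (fps_X ^ e) * fps_X * geo e) $ j"
    by (cases j) (simp_all add: geo_def mult.assoc power_add)
qed

lemma complete_sym_0 [simp]: "complete_sym A 0 = 1"
  unfolding complete_sym_def by (induction A) (simp_all add: geo_def)

lemma complete_sym_empty: "complete_sym {#} (Suc j) = 0"
  by (simp add: complete_sym_def)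

text \<open>Clear the denominator \<open>1 - q ^ e * z\<close> of the new factor and compare
  coefficients.\<close>

lemma complete_sym_add_mset:
  "complete_sym (add_mset e A) (Suc j) =
     complete_sym A (Suc j) + fps_X ^ e * complete_sym (add_mset e A) j"
proof -
  let ?P = "\<Prod>e\<in>#A. geo e"
  have "geo e * ?P = ?P + fps_const (fps_X ^ e) * (fps_X * (geo e * ?P))"
    by (subst geo_eq) (simp add: algebra_simps)
  then have "(geo e * ?P) $ Suc j =
      (?P + fps_const (fps_X ^ e) * (fps_X * (geo e * ?P))) $ Suc j" by (rule arg_cong)
  then have "(geo e * ?P) $ Suc j = ?P $ Suc j + fps_X ^ e * (geo e * ?P) $ j"
    by simp
  then show ?thesis by (simp add: complete_sym_def)
qed

lemma qfact_nth_0 [simp]: "qfact k $ 0 = 1"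
  by (induction k) (simp_all add: qfact_def)

lemma inverse_qfact_Suc: "inverse (qfact k) = (1 - fps_X ^ Suc k) * inverse (qfact (Suc k))"
proof -
  have "qfact (Suc k) = qfact k * (1 - fps_X ^ Suc k)" by (simp add: qfact_def)
  then show ?thesis
    by (simp add: fps_inverse_mult inverse_mult_eq_1' flip: power_Suc del: power_Suc)
qed

lemma fps_infsum_add: "fps_infsum (\<lambda>j. t j + u j) = fps_infsum t + fps_infsum u"
  by (rule fps_ext) (simp add: fps_infsum_def sum.distrib)

lemma fps_infsum_uminus: "fps_infsum (\<lambda>j. - t j) = - fps_infsum t"
  by (rule fps_ext) (simp add: fps_infsum_def sum_negf)

lemma fps_X_power_dvd_nth: "fps_X ^ j dvd (f :: rat fps) \<Longrightarrow> i < j \<Longrightarrow> f $ i = 0"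
  by (auto simp: dvd_def fps_X_power_mult_nth)

text \<open>The cutoffs \<open>N\<close> and \<open>N - i\<close> differ; divisibility makes the
  surplus terms vanish.\<close>

lemma fps_infsum_mult:
  assumes "\<And>j. fps_X ^ j dvd t j"
  shows "fps_infsum (\<lambda>j. c * t j) = c * fps_infsum t"
proof (rule fps_ext)
  fix N
  have "fps_infsum (\<lambda>j. c * t j) $ N = (\<Sum>j\<le>N. \<Sum>i=0..N. c $ i * t j $ (N - i))"
    by (simp add: fps_infsum_def fps_mult_nth)
  also have "\<dots> = (\<Sum>i=0..N. \<Sum>j\<le>N. c $ i * t j $ (N - i))" by (rule sum.swap)
  also have "\<dots> = (\<Sum>i=0..N. c $ i * (\<Sum>j\<le>N - i. t j $ (N - i)))"
  proof (rule sum.cong[OF refl])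
    fix i
    have "(\<Sum>j\<le>N. t j $ (N - i)) = (\<Sum>j\<le>N - i. t j $ (N - i))"
      by (rule sum.mono_neutral_right) (use fps_X_power_dvd_nth[OF assms] in auto)
    then show "(\<Sum>j\<le>N. c $ i * t j $ (N - i)) = c $ i * (\<Sum>j\<le>N - i. t j $ (N - i))"
      by (simp flip: sum_distrib_left)
  qed
  also have "\<dots> = (c * fps_infsum t) $ N" by (simp add: fps_infsum_def fps_mult_nth)
  finally show "fps_infsum (\<lambda>j. c * t j) $ N = (c * fps_infsum t) $ N" .
qed

text \<open>Reindexing moves the cutoff by one; the stronger divisibility makes the lost term
  \<open>j = N\<close> vanish.\<close>

lemma fps_infsum_shift:
  assumes "\<And>j. fps_X ^ Suc j dvd t j"
  shows "fps_infsum (\<lambda>j. case j of 0 \<Rightarrow> 0 | Suc i \<Rightarrow> t i) = fps_infsum t"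
proof (rule fps_ext)
  fix N
  have "t N $ N = 0" by (rule fps_X_power_dvd_nth[OF assms]) simp
  then have "(\<Sum>j\<le>N. t j $ N) = (\<Sum>j<N. t j $ N)" by (simp flip: lessThan_Suc_atMost)
  then show "fps_infsum (\<lambda>j. case j of 0 \<Rightarrow> 0 | Suc i \<Rightarrow> t i) $ N = fps_infsum t $ N"
    by (cases N) (simp_all add: fps_infsum_def sum.lessThan_Suc_shift flip: lessThan_Suc_atMost
        del: sum.lessThan_Suc)
qed

lemma le_sum_atMost: "j \<le> \<Sum>{..j::nat}"
  by (cases j) auto

lemma rook_term_dvd:
  assumes "N \<le> n + \<Sum>{..j} + s * (k + j)"
  shows "fps_X ^ N dvd rook_term n k A s j"
  unfolding rook_term_def by (intro dvd_mult2 dvd_mult le_imp_power_dvd assms)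

text \<open>For \<open>k > 0\<close> the series tends to 0 as \<open>s\<close> grows, which later
  pins down the solution of the recursion.\<close>

lemma rook_series_nth_eq_0:
  assumes "N < s * k"
  shows "rook_series n k A s $ N = 0"
proof -
  have "rook_term n k A s j $ N = 0" for j
    by (rule fps_X_power_dvd_nth[OF rook_term_dvd[of "s * k"] assms]) (simp add: algebra_simps)
  then show ?thesis by (simp add: rook_series_def fps_infsum_def)
qed

lemma rook_series_empty: "rook_series 0 0 {#} s = 1"
proof (rule fps_ext)
  fix N
  have *: "rook_term 0 0 {#} s j = (if j = 0 then 1 else 0)" for j
    by (cases j) (simp_all add: rook_term_def qfact_def complete_sym_empty)
  show "rook_series 0 0 {#} s $ N = 1 $ N"
    by (simp add: rook_series_def fps_infsum_def * if_distrib[of "\<lambda>f. f $ N"] cong: if_cong)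
qed

lemma rook_term_rec_0:
  "rook_term (n + c) (Suc k) (add_mset (c + k) A) s 0 =
     fps_X ^ (s + c) * rook_term n k A s 0 +
     rook_term (n + c) (Suc k) (add_mset (c + k) A) (Suc s) 0"
proof -
  define U where "U = inverse (qfact (Suc k))"
  have U: "inverse (qfact k) = (1 - fps_X ^ Suc k) * U"
    using inverse_qfact_Suc[of k] by (simp add: U_def)
  show ?thesis by (simp add: rook_term_def U power_add algebra_simps flip: U_def)
qed

text \<open>Splitting the new variable \<open>y\<close> off \<open>complete_sym\<close> and the
  factor \<open>1 - x\<close> off \<open>qfact\<close> gives all four terms the common factors
  \<open>P\<close> and \<open>U\<close>; what remains is a polynomial identity.\<close>

lemma rook_term_rec_Suc:
  "rook_term (n + c) (Suc k) (add_mset (c + k) A) s (Suc j) =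
     fps_X ^ (s + c) * rook_term n k A s (Suc j) +
     rook_term (n + c) (Suc k) (add_mset (c + k) A) (Suc s) (Suc j) -
     fps_X ^ (s + c) * rook_term (n + c) (Suc k) (add_mset (c + k) A) (Suc s) j"
proof -
  let ?A = "add_mset (c + k) A"
  define P :: "rat fps" where "P = (- 1) ^ j * fps_X ^ (n + c + \<Sum>{..j} + Suc j + s * (k + j + 2))"
  define x :: "rat fps" where "x = fps_X ^ (k + j + 2)"
  define y :: "rat fps" where "y = fps_X ^ (c + k)"
  define h where "h = complete_sym A (Suc j)"
  define h' where "h' = complete_sym ?A j"
  define U where "U = inverse (qfact (k + j + 2))"
  have U: "inverse (qfact (Suc (k + j))) = (1 - x) * U"
    using inverse_qfact_Suc[of "Suc (k + j)"] by (simp add: U_def x_def)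
  have 1: "rook_term (n + c) (Suc k) ?A s (Suc j) = - (P * (h + y * h') * U)"
    by (simp add: rook_term_def complete_sym_add_mset P_def h_def h'_def y_def U_def algebra_simps)
  have 2: "rook_term (n + c) (Suc k) ?A (Suc s) (Suc j) = - (P * x * (h + y * h') * U)"
    by (simp add: rook_term_def complete_sym_add_mset P_def h_def h'_def y_def U_def x_def
        power_add algebra_simps)
  have 3: "fps_X ^ (s + c) * rook_term n k A s (Suc j) = - (P * h * ((1 - x) * U))"
    by (simp add: rook_term_def P_def h_def power_add algebra_simps U U[unfolded add.commute[of k j]])
  have 4: "fps_X ^ (s + c) * rook_term (n + c) (Suc k) ?A (Suc s) j = P * y * h' * ((1 - x) * U)"
    by (simp add: rook_term_def P_def h'_def y_def power_add algebra_simps U U[unfolded add.commute[of k j]])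
  show ?thesis unfolding 1 2 3 4 by (simp add: algebra_simps)
qed

text \<open>Think of \<open>c\<close> as the length of the row matched next. A part of size
  \<open>s + c\<close> is used at once, with excess \<open>s\<close>; if none occurs, the bound
  rises to \<open>Suc s\<close>, and \<open>1 - q ^ (s + c)\<close> removes that size from the
  generating function of all partitions.\<close>

lemma rook_series_rec:
  "rook_series (n + c) (Suc k) (add_mset (c + k) A) s =
     fps_X ^ (s + c) * rook_series n k A s +
     (1 - fps_X ^ (s + c)) * rook_series (n + c) (Suc k) (add_mset (c + k) A) (Suc s)"
proof -
  let ?t = "rook_term n k A s"
  let ?y = "\<lambda>s. rook_term (n + c) (Suc k) (add_mset (c + k) A) s"
  let ?q = "fps_X ^ (s + c) :: rat fps"
  have 1: "?y s = (\<lambda>j. ?q * ?t j + (?y (Suc s) j +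
      (case j of 0 \<Rightarrow> 0 | Suc i \<Rightarrow> - (?q * ?y (Suc s) i))))"
  proof
    fix j
    show "?y s j = ?q * ?t j + (?y (Suc s) j + (case j of 0 \<Rightarrow> 0 | Suc i \<Rightarrow> - (?q * ?y (Suc s) i)))"
      using rook_term_rec_0[of n c k A s] rook_term_rec_Suc[of n c k A s]
      by (cases j) simp_all
  qed
  have "fps_X ^ j dvd ?t j" for j
    by (rule rook_term_dvd) (use le_sum_atMost[of j] in simp)
  then have 2: "fps_infsum (\<lambda>j. ?q * ?t j) = ?q * fps_infsum ?t" by (rule fps_infsum_mult)
  have Suc_dvd: "fps_X ^ Suc j dvd ?y (Suc s) j" for j
    by (rule rook_term_dvd) (use le_sum_atMost[of j] in simp)
  then have "fps_X ^ j dvd ?y (Suc s) j" for j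
    by (rule dvd_trans[OF le_imp_power_dvd, rotated]) simp
  then have 3: "fps_infsum (\<lambda>j. ?q * ?y (Suc s) j) = ?q * fps_infsum (?y (Suc s))"
    by (rule fps_infsum_mult)
  have 4: "fps_infsum (\<lambda>j. case j of 0 \<Rightarrow> 0 | Suc i \<Rightarrow> - (?q * ?y (Suc s) i)) =
      - (?q * fps_infsum (?y (Suc s)))"
    using Suc_dvd by (subst fps_infsum_shift) (auto simp: fps_infsum_uminus 3)
  show ?thesis
    unfolding rook_series_def by (subst 1) (simp only: fps_infsum_add 2 4, simp add: algebra_simps)
qed

section \<open>Recovering the multiset from its series\<close>

text \<open>Modulo \<open>q ^ \<beta>\<close> every factor \<open>geo e\<close> with
  \<open>\<beta> \<le> e\<close> is 1.\<close>

lemma prod_geo_cong_filter: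
  "fps_const (fps_X ^ \<beta>) dvd (\<Prod>e\<in>#A. geo e) - (\<Prod>e\<in>#filter_mset (\<lambda>e. e < \<beta>) A. geo e)"
proof (induction A)
  case (add e A)
  let ?c = "fps_const (fps_X ^ \<beta>) :: rat fps fps"
  let ?P = "\<Prod>e\<in>#A. geo e" and ?Q = "\<Prod>e\<in>#filter_mset (\<lambda>e. e < \<beta>) A. geo e"
  show ?case
  proof (cases "e < \<beta>")
    case True
    then show ?thesis using dvd_mult[OF add, of "geo e"] by (simp add: algebra_simps)
  next
    case False
    then have "fps_X ^ e = (fps_X ^ \<beta> * fps_X ^ (e - \<beta>) :: rat fps)" by (simp flip: power_add)
    then have "geo e = 1 + ?c * (fps_const (fps_X ^ (e - \<beta>)) * fps_X * geo e)"
      by (subst geo_eq) (simp add: mult.assoc flip: fps_const_mult)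
    then obtain K where K: "geo e = 1 + ?c * K" by blast
    have eq: "geo e * ?P - ?Q = (?P - ?Q) + ?c * (K * ?P)"
      unfolding K by (simp add: algebra_simps)
    have "?c dvd geo e * ?P - ?Q" unfolding eq using add by (intro dvd_add) auto
    then show ?thesis using False by simp
  qed
qed simp

lemma complete_sym_1: "complete_sym A 1 = (\<Sum>e\<in>#A. fps_X ^ e)"
proof (induction A)
  case (add e A)
  then show ?case using complete_sym_add_mset[of e A 0] by simp
qed (simp add: complete_sym_def)

lemma sum_fps_X_power_nth: "(\<Sum>e\<in>#A. fps_X ^ e) $ b = (of_nat (count A b) :: rat)"
  by (induction A) auto

lemma rook_series_inj:
  assumes eq: "rook_series n k A 0 = rook_series n k B 0"
  shows "A = B"
proof (rule ccontr)
  assume "A \<noteq> B"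
  then have ex: "\<exists>b. count A b \<noteq> count B b" by (auto simp: multiset_eq_iff)
  define \<beta> where "\<beta> = (LEAST b. count A b \<noteq> count B b)"
  have \<beta>: "count A \<beta> \<noteq> count B \<beta>" unfolding \<beta>_def using ex by (rule LeastI_ex)
  have "filter_mset (\<lambda>e. e < \<beta>) A = filter_mset (\<lambda>e. e < \<beta>) B"
    by (rule multiset_eqI) (auto simp: \<beta>_def dest: not_less_Least)
  then have "fps_const (fps_X ^ \<beta>) dvd (\<Prod>e\<in>#A. geo e) - (\<Prod>e\<in>#B. geo e)"
    using dvd_diff[OF prod_geo_cong_filter[of \<beta> A] prod_geo_cong_filter[of \<beta> B]] by simp
  then have dvd: "fps_X ^ \<beta> dvd complete_sym A j - complete_sym B j" for j
    unfolding complete_sym_def fps_sub_nth[symmetric]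
    by (elim dvdE) (simp only: fps_mult_left_const_nth dvd_triv_left)
  define N where "N = n + 1 + \<beta>"
  have tdiff: "rook_term n k A 0 j - rook_term n k B 0 j =
      (- 1) ^ j * inverse (qfact (k + j)) * (fps_X ^ (n + \<Sum>{..j}) *
        (complete_sym A j - complete_sym B j))" for j
    by (simp add: rook_term_def algebra_simps)
  \<comment> \<open>For \<open>2 \<le> j\<close> the sum \<open>\<Sum>{..j}\<close> is at least 3,
    so the difference starts beyond \<open>q ^ N\<close>.\<close>
  have high: "(rook_term n k A 0 j - rook_term n k B 0 j) $ N = 0" if "j \<ge> 2" for j
  proof -
    have "j = Suc (Suc (j - 2))" using that by simp
    then obtain i where i: "j = Suc (Suc i)" ..
    have "fps_X ^ (n + \<Sum>{..j} + \<beta>) dvd rook_term n k A 0 j - rook_term n k B 0 j"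
      unfolding tdiff power_add[of _ _ \<beta>] by (rule dvd_mult, rule mult_dvd_mono[OF dvd_refl dvd])
    then show ?thesis by (rule fps_X_power_dvd_nth) (simp add: N_def i)
  qed
  have "(rook_term n k A 0 1 - rook_term n k B 0 1) $ N =
      - ((inverse (qfact (k + 1)) * (complete_sym A 1 - complete_sym B 1)) $ \<beta>)"
    unfolding tdiff by (simp add: N_def mult.left_commute[of _ "fps_X ^ _"] fps_X_power_mult_nth
        del: power_Suc One_nat_def) (simp add: fps_X_power_mult_nth)
  \<comment> \<open>The difference starts at \<open>q ^ \<beta>\<close>, so only the constant
    coefficient 1 of the inverse matters.\<close>
  also have "(inverse (qfact (k + 1)) * (complete_sym A 1 - complete_sym B 1)) $ \<beta> =
      (complete_sym A 1 - complete_sym B 1) $ \<beta>"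
  proof -
    obtain K where K: "complete_sym A 1 - complete_sym B 1 = fps_X ^ \<beta> * K"
      using dvd[of 1] by (auto simp: dvd_def)
    show ?thesis
      unfolding K by (simp add: mult.left_commute[of _ "fps_X ^ _"] fps_X_power_mult_nth)
  qed
  finally have one: "(rook_term n k A 0 1 - rook_term n k B 0 1) $ N \<noteq> 0"
    using \<beta> by (simp add: complete_sym_1 sum_fps_X_power_nth flip: One_nat_def)
  have "0 = (rook_series n k A 0 - rook_series n k B 0) $ N" using eq by simp
  also have "\<dots> = (\<Sum>j\<le>N. (rook_term n k A 0 j - rook_term n k B 0 j) $ N)"
    by (simp add: rook_series_def fps_infsum_def sum_subtractf)
  also have "\<dots> = (\<Sum>j\<in>{1}. (rook_term n k A 0 j - rook_term n k B 0 j) $ N)"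
  proof (rule sum.mono_neutral_right)
    show "\<forall>j\<in>{..N} - {1}. (rook_term n k A 0 j - rook_term n k B 0 j) $ N = 0"
    proof
      fix j assume "j \<in> {..N} - {1}"
      then have "j = 0 \<or> j \<ge> 2" by auto
      then show "(rook_term n k A 0 j - rook_term n k B 0 j) $ N = 0"
        using high[of j] by (auto simp: rook_term_def)
    qed
  qed (auto simp: N_def)
  finally show False using one by simp
qed

section \<open>Counting the partitions that contain a pattern\<close>

text \<open>Increasing order is the order in which \<open>greedy\<close> reads; a part equal to the
  bound \<open>h\<close> stands at the head.\<close>

definition part_lists :: "nat \<Rightarrow> nat \<Rightarrow> nat list set" where
  "part_lists h N = {xs. sorted xs \<and> (\<forall>x\<in>set xs. h \<le> x) \<and> sum_list xs = N}"

definition part_gf :: "nat \<Rightarrow> (nat list \<Rightarrow> bool) \<Rightarrow> rat fps" where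
  "part_gf h P = Abs_fps (\<lambda>N. of_nat (card {xs \<in> part_lists h N. P xs}))"

lemma finite_part_lists:
  assumes "1 \<le> h"
  shows "finite (part_lists h N)"
proof (rule finite_subset[OF _ finite_lists_length_le[of "{..N}" N]])
  show "part_lists h N \<subseteq> {xs. set xs \<subseteq> {..N} \<and> length xs \<le> N}"
  proof
    fix xs assume xs: "xs \<in> part_lists h N"
    then have pos: "1 \<le> x" if "x \<in> set xs" for x
      using assms that by (auto simp: part_lists_def)
    have "(\<Sum>x\<leftarrow>xs. 1) \<le> (\<Sum>x\<leftarrow>xs. x)" using pos by (intro sum_list_mono) auto
    then have "length xs \<le> N" using xs by (simp add: part_lists_def sum_list_triv)
    moreover have "x \<le> N" if "x \<in> set xs" for x
      using member_le_sum_list[OF that] xs by (simp add: part_lists_def)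
    ultimately show "xs \<in> {xs. set xs \<subseteq> {..N} \<and> length xs \<le> N}" by auto
  qed
qed simp

lemma part_lists_split:
  "{xs \<in> part_lists h N. P xs} =
     {xs \<in> part_lists (Suc h) N. P xs} \<union>
     (#) h ` {xs. h \<le> N \<and> xs \<in> part_lists h (N - h) \<and> P (h # xs)}" (is "?L = ?A \<union> ?B")
proof
  show "?A \<union> ?B \<subseteq> ?L" by (fastforce simp: part_lists_def)
  show "?L \<subseteq> ?A \<union> ?B"
  proof
    fix xs assume xs: "xs \<in> ?L"
    show "xs \<in> ?A \<union> ?B"
    proof (cases "h \<in> set xs")
      case True
      then obtain y ys where ys: "xs = y # ys" by (cases xs) auto
      have "y = h" using True xs ys by (fastforce simp: part_lists_def)
      then show ?thesis using xs ys by (auto simp: part_lists_def)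
    next
      case False
      have "Suc h \<le> x" if "x \<in> set xs" for x
      proof -
        have "h \<le> x" "h \<noteq> x" using xs that False by (auto simp: part_lists_def)
        then show ?thesis by simp
      qed
      then show ?thesis using xs by (auto simp: part_lists_def)
    qed
  qed
qed

text \<open>Split by whether the smallest part is \<open>h\<close>. If so, it is removed and
  remembered in the predicate; the bound stays \<open>h\<close>, since parts may repeat.\<close>

lemma part_gf_rec:
  assumes h: "1 \<le> h"
  shows "part_gf h P = fps_X ^ h * part_gf h (\<lambda>xs. P (h # xs)) + part_gf (Suc h) P"
proof (rule fps_ext)
  fix N
  let ?A = "{xs \<in> part_lists (Suc h) N. P xs}"
  let ?B = "{xs. h \<le> N \<and> xs \<in> part_lists h (N - h) \<and> P (h # xs)}"
  have A: "finite ?A"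
  proof (rule finite_subset)
    show "?A \<subseteq> part_lists (Suc h) N" by (intro subsetI) (elim CollectE conjE)
  qed (rule finite_part_lists, simp)
  have B: "finite ?B"
  proof (rule finite_subset)
    show "?B \<subseteq> part_lists h (N - h)" by (intro subsetI) (elim CollectE conjE)
  qed (rule finite_part_lists[OF h])
  have "h # ys \<notin> part_lists (Suc h) N" for ys by (simp add: part_lists_def)
  then have "?A \<inter> (#) h ` ?B = {}" by blast
  moreover have "card ((#) h ` ?B) = card ?B" by (rule card_image) simp
  ultimately have "card (?A \<union> (#) h ` ?B) = card ?A + card ?B"
    using card_Un_disjoint[OF A finite_imageI[OF B]] by simp
  then have card: "card {xs \<in> part_lists h N. P xs} = card ?A + card ?B"
    by (subst part_lists_split)
  show "part_gf h P $ N =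
      (fps_X ^ h * part_gf h (\<lambda>xs. P (h # xs)) + part_gf (Suc h) P) $ N"
    by (cases "h \<le> N") (simp_all add: part_gf_def card fps_X_power_mult_nth)
qed

lemma part_gf_True_rec:
  assumes "1 \<le> h"
  shows "part_gf (Suc h) (\<lambda>_. True) = (1 - fps_X ^ h) * part_gf h (\<lambda>_. True)"
  using part_gf_rec[OF assms, of "\<lambda>_. True"] by (simp add: algebra_simps)

lemma part_gf_nth_eq_0:
  assumes "\<not> P []" "N < h"
  shows "part_gf h P $ N = 0"
proof -
  have "{xs \<in> part_lists h N. P xs} = {}"
  proof (rule ccontr)
    assume "{xs \<in> part_lists h N. P xs} \<noteq> {}"
    then obtain xs where xs: "xs \<in> part_lists h N" "P xs" by blast
    then obtain x where "x \<in> set xs" using assms(1) by (cases xs) auto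
    then have "h \<le> N" using xs member_le_sum_list[of x xs] by (force simp: part_lists_def)
    then show False using assms(2) by simp
  qed
  then show ?thesis unfolding part_gf_def fps_nth_Abs_fps by (simp only: card.empty of_nat_0)
qed

text \<open>Induction on the number \<open>k\<close> of rows to be matched. The next matched part
  has size at least \<open>h\<close> and excess at least \<open>s\<close>, hence excess at least the
  given maximum; for \<open>k = 0\<close> the series is 1 whatever the bound.\<close>

lemma part_gf_greedy:
  assumes anti: "antimono \<mu>" and h: "1 \<le> h"
  shows "part_gf h (greedy \<mu> s k) = part_gf h (\<lambda>_. True) *
    rook_series (sum \<mu> {..<k}) k (row_shifts \<mu> k) (max s (h - \<mu> (k - 1)))"
  using h
proof (induction k arbitrary: h s)
  case 0
  have "greedy \<mu> s 0 = (\<lambda>_. True)" by (rule ext) simp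
  then show ?case by (simp add: rook_series_empty)
next
  case (Suc k)
  note IH_k = Suc.IH
  let ?c = "\<mu> k" and ?g = "greedy \<mu> s (Suc k)"
  define p where "p h = part_gf h (\<lambda>_. True)" for h
  define S where "S = rook_series (sum \<mu> {..<k}) k (row_shifts \<mu> k)"
  define S' where "S' = rook_series (sum \<mu> {..<Suc k}) (Suc k) (row_shifts \<mu> (Suc k))"
  define D where "D h = part_gf h ?g - p h * S' (max s (h - ?c))" for h
  have S'_rec: "S' t = fps_X ^ (t + ?c) * S t + (1 - fps_X ^ (t + ?c)) * S' (Suc t)" for t
    using rook_series_rec[of "sum \<mu> {..<k}" ?c k "row_shifts \<mu> k" t]
    by (simp add: S_def S'_def row_shifts_Suc)
  have p_rec: "p (Suc h) = (1 - fps_X ^ h) * p h" if "1 \<le> h" for h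
    using part_gf_True_rec[OF that] by (simp add: p_def)
  \<comment> \<open>This makes the maximum in the induction hypothesis for \<open>k\<close> collapse
    to \<open>h - ?c\<close>.\<close>
  have ck: "?c \<le> \<mu> (k - 1)" using anti by (auto intro: antimonoD)
  \<comment> \<open>Both sides satisfy one first-order recursion in \<open>h\<close> and tend to \<open>0\<close> in the \<open>q\<close>-adic topology
    as \<open>h\<close> grows; hence downward induction on \<open>h\<close>, one initial segment of coefficients at a time.\<close>
  have D_nth: "\<forall>N<K. D h $ N = 0" if "1 \<le> h" "K + ?c + s \<le> h + d" for K h d
    using that
  proof (induction d arbitrary: h)
    case 0
    show ?case
    proof (intro allI impI)
      fix N assume N: "N < K"
      have "part_gf h ?g $ N = 0" by (rule part_gf_nth_eq_0) (use 0 N in auto)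
      moreover have "S' (max s (h - ?c)) $ i = 0" if "i \<le> N" for i
        unfolding S'_def by (rule rook_series_nth_eq_0) (use 0 N that in auto)
      ultimately show "D h $ N = 0" by (simp add: D_def fps_mult_nth)
    qed
  next
    case (Suc d)
    have IH: "\<forall>N<K. D (Suc h) $ N = 0" by (rule Suc.IH) (use Suc.prems in auto)
    show ?case
    proof (cases "?c + s \<le> h")
      case True
      \<comment> \<open>The part \<open>h\<close> is matched with row \<open>k\<close>; on the
        series side this is \<open>S'_rec\<close> at \<open>t = h - ?c\<close>, where
        \<open>t + ?c = h\<close>.\<close>
      have g: "(\<lambda>xs. ?g (h # xs)) = greedy \<mu> (h - ?c) k" using True by auto
      have m: "max s (h - ?c) = h - ?c" "max s (Suc h - ?c) = Suc h - ?c" using True by auto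
      have 1: "part_gf h ?g = fps_X ^ h * (p h * S (h - ?c)) + part_gf (Suc h) ?g"
        using part_gf_rec[OF Suc.prems(1), of ?g] IH_k[OF Suc.prems(1), of "h - ?c"] ck
        unfolding g by (simp add: p_def S_def max_absorb1)
      have 2: "S' (h - ?c) = fps_X ^ h * S (h - ?c) + (1 - fps_X ^ h) * S' (Suc h - ?c)"
        using S'_rec[of "h - ?c"] True by (simp add: Suc_diff_le)
      have "D h = D (Suc h)"
        unfolding D_def m 1 2 p_rec[OF Suc.prems(1)] by (simp add: algebra_simps)
      then show ?thesis using IH by simp
    next
      case False
      \<comment> \<open>Parts of size \<open>h\<close> are too small and get skipped, so passing to
        \<open>Suc h\<close> multiplies both sides by \<open>1 - q ^ h\<close>. As
        \<open>1 \<le> h\<close>, the equation fixes \<open>D h\<close> coefficient by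
        coefficient.\<close>
      have g: "(\<lambda>xs. ?g (h # xs)) = ?g" using False by auto
      have m: "max s (h - ?c) = s" "max s (Suc h - ?c) = s" using False by auto
      have "part_gf (Suc h) ?g = part_gf h ?g - fps_X ^ h * part_gf h ?g"
        using part_gf_rec[OF Suc.prems(1), of ?g] unfolding g by (simp add: algebra_simps)
      then have D: "D h = fps_X ^ h * D h + D (Suc h)"
        unfolding D_def m p_rec[OF Suc.prems(1)] by (simp add: algebra_simps)
      have "N < K \<Longrightarrow> D h $ N = 0" for N
      proof (induction N rule: less_induct)
        case (less N)
        have "D h $ N = (fps_X ^ h * D h + D (Suc h)) $ N" using D by simp
        also have "\<dots> = 0" using less IH \<open>1 \<le> h\<close> by (auto simp: fps_X_power_mult_nth)
        finally show ?case .
      qed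
      then show ?thesis by blast
    qed
  qed
  have "D h $ N = 0" for N
    using D_nth[OF Suc.prems, of "Suc N" "Suc N + ?c + s"] by simp
  then have "D h = 0" by (simp add: fps_eq_iff)
  then show ?case by (simp add: D_def p_def S'_def)
qed

section \<open>Passing from lists of parts to partitions\<close>

lemma partition_support:
  assumes "is_partition \<mu>"
  shows "\<mu> i \<noteq> 0 \<longleftrightarrow> i < card {i. \<mu> i \<noteq> 0}"
proof -
  have fin: "finite {i. \<mu> i \<noteq> 0}" and anti: "antimono \<mu>" using assms by (auto simp: is_partition_def)
  define l where "l = (LEAST i. \<mu> i = 0)"
  have "\<exists>i. \<mu> i = 0" using fin ex_new_if_finite[OF infinite_UNIV_nat fin] by auto
  then have l: "\<mu> l = 0" unfolding l_def by (rule LeastI_ex)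
  have "\<mu> i \<noteq> 0 \<longleftrightarrow> i < l" for i
  proof
    show "i < l" if "\<mu> i \<noteq> 0"
      using that l antimonoD[OF anti, of l i] by (cases "i < l") auto
    show "\<mu> i \<noteq> 0" if "i < l" using that not_less_Least unfolding l_def by blast
  qed
  then have "{i. \<mu> i \<noteq> 0} = {..<l}" by auto
  then show ?thesis by auto
qed

text \<open>The bijection \<open>g\<close> lists the nonzero parts from the bottom row upwards; its
  inverse \<open>f\<close> reverses the list and pads it with zeros.\<close>

lemma card_partitions_containing:
  assumes "is_partition \<mu>" and l_def: "l = card {i. \<mu> i \<noteq> 0}"
  shows "card (partitions_containing N \<mu>) = card {xs \<in> part_lists 1 N. greedy \<mu> 0 l xs}"
proof -
  define g where "g \<alpha> = rev (map \<alpha> [0..<card {i. \<alpha> i \<noteq> 0}])" for \<alpha> :: "nat \<Rightarrow> nat"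
  define f where "f xs i = (if i < length xs then rev xs ! i else 0)" for xs :: "nat list" and i
  have contains: "contains_pattern \<alpha> \<mu> \<longleftrightarrow> greedy \<mu> 0 l (g \<alpha>)" if "is_partition \<alpha>" for \<alpha>
  proof -
    have anti: "antimono \<alpha>" "antimono \<mu>" using that assms(1) by (simp_all add: is_partition_def)
    have supp: "\<mu> i \<noteq> 0 \<longleftrightarrow> i < l" for i unfolding l_def by (rule partition_support[OF assms(1)])
    show ?thesis
      unfolding contains_pattern_iff_rows[OF anti supp] g_def
      by (rule greedy_iff_rows[OF anti(1) partition_support[OF that], symmetric])
        (rule supp[THEN iffD2])
  qed
  have sum_g: "sum_list (g \<alpha>) = (\<Sum>i | \<alpha> i \<noteq> 0. \<alpha> i)" if "is_partition \<alpha>" for \<alpha>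
  proof -
    have "{i. \<alpha> i \<noteq> 0} = {..<card {i. \<alpha> i \<noteq> 0}}"
      using partition_support[OF that] by blast
    then have "(\<Sum>i | \<alpha> i \<noteq> 0. \<alpha> i) = sum \<alpha> {..<card {i. \<alpha> i \<noteq> 0}}" by (rule sum.cong) simp
    also have "\<dots> = sum_list (g \<alpha>)"
      by (simp add: g_def interv_sum_list_conv_sum_set_nat atLeast0LessThan)
    finally show ?thesis ..
  qed
  have fg: "f (g \<alpha>) = \<alpha>" if "is_partition \<alpha>" for \<alpha>
  proof
    fix i
    show "f (g \<alpha>) i = \<alpha> i"
      using partition_support[OF that, of i] by (cases "\<alpha> i = 0") (simp_all add: f_def g_def)
  qed
  have gf: "g (f xs) = xs" and pf: "is_partition (f xs)" if "xs \<in> part_lists 1 N" for xs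
  proof -
    have pos: "f xs i \<noteq> 0 \<longleftrightarrow> i < length xs" for i
      using that nth_mem[of i "rev xs"] by (force simp: f_def part_lists_def)
    then have supp: "{i. f xs i \<noteq> 0} = {..<length xs}" by blast
    then have card: "card {i. f xs i \<noteq> 0} = length xs" by simp
    have "map (f xs) [0..<length xs] = rev xs"
      by (rule nth_equalityI) (auto simp: f_def)
    then show "g (f xs) = xs" unfolding g_def card by simp
    have "antimono (f xs)"
    proof (rule antimonoI)
      fix i j :: nat assume "i \<le> j"
      then show "f xs j \<le> f xs i"
        using that by (auto simp: f_def part_lists_def rev_nth intro: sorted_nth_mono)
    qed
    then show "is_partition (f xs)" unfolding is_partition_def supp by simp
  qed
  have "bij_betw g (partitions_containing N \<mu>) {xs \<in> part_lists 1 N. greedy \<mu> 0 l xs}"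
  proof (rule bij_betw_byWitness[where f' = f])
    show "\<forall>\<alpha>\<in>partitions_containing N \<mu>. f (g \<alpha>) = \<alpha>"
      using fg by (auto simp: partitions_containing_def partition_of_def)
    show "\<forall>xs\<in>{xs \<in> part_lists 1 N. greedy \<mu> 0 l xs}. g (f xs) = xs" using gf by blast
    show "g ` partitions_containing N \<mu> \<subseteq> {xs \<in> part_lists 1 N. greedy \<mu> 0 l xs}"
    proof clarify
      fix \<alpha> assume "\<alpha> \<in> partitions_containing N \<mu>"
      then have \<alpha>: "is_partition \<alpha>" "(\<Sum>i | \<alpha> i \<noteq> 0. \<alpha> i) = N" "contains_pattern \<alpha> \<mu>"
        by (auto simp: partitions_containing_def partition_of_def)
      have "sorted (g \<alpha>)" unfolding g_def sorted_wrt_rev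
        using \<alpha>(1) by (simp add: sorted_wrt_map sorted_wrt_iff_nth_less is_partition_def antimono_def)
      moreover have "\<forall>x\<in>set (g \<alpha>). 1 \<le> x"
      proof
        fix x assume "x \<in> set (g \<alpha>)"
        then obtain i where "x = \<alpha> i" "i < card {i. \<alpha> i \<noteq> 0}" by (auto simp: g_def)
        then show "1 \<le> x" using partition_support[OF \<alpha>(1), of i] by simp
      qed
      ultimately show "g \<alpha> \<in> part_lists 1 N \<and> greedy \<mu> 0 l (g \<alpha>)"
        using \<alpha> contains[OF \<alpha>(1)] sum_g[OF \<alpha>(1)] by (simp add: part_lists_def)
    qed
    show "f ` {xs \<in> part_lists 1 N. greedy \<mu> 0 l xs} \<subseteq> partitions_containing N \<mu>"
    proof clarify
      fix xs assume xs: "xs \<in> part_lists 1 N" "greedy \<mu> 0 l xs"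
      then show "f xs \<in> partitions_containing N \<mu>"
        using contains[OF pf[OF xs(1)]] sum_g[OF pf[OF xs(1)]] gf[OF xs(1)] pf[OF xs(1)]
        by (simp add: partitions_containing_def partition_of_def part_lists_def)
    qed
  qed
  then show ?thesis by (rule bij_betw_same_card)
qed

text \<open>For a zero row the recursion degenerates at \<open>s = 0\<close>:
  \<open>1 - q ^ 0\<close> is 0 and the first summand has factor 1. So every partition of
  \<open>n\<close> can be given exactly \<open>n\<close> rows.\<close>

lemma rook_series_pad:
  assumes "\<And>i. l \<le> i \<Longrightarrow> \<mu> i = 0" "l \<le> k"
  shows "rook_series (sum \<mu> {..<k}) k (row_shifts \<mu> k) 0 =
    rook_series (sum \<mu> {..<l}) l (row_shifts \<mu> l) 0"
  using assms(2)
proof (induction k rule: dec_induct)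
  case (step k)
  then show ?case
    using rook_series_rec[of "sum \<mu> {..<k}" 0 k "row_shifts \<mu> k" 0] assms(1)[of k]
    by (simp add: row_shifts_Suc)
qed simp

lemma wilf_gf:
  assumes \<mu>: "partition_of \<mu> n"
  shows "of_nat (card (partitions_containing N \<mu>)) =
    (part_gf 1 (\<lambda>_. True) * rook_series n n (row_shifts \<mu> n) 0) $ N"
proof -
  define l where "l = card {i. \<mu> i \<noteq> 0}"
  have part: "is_partition \<mu>" and anti: "antimono \<mu>" and sum: "(\<Sum>i | \<mu> i \<noteq> 0. \<mu> i) = n"
    using \<mu> by (auto simp: partition_of_def is_partition_def)
  have supp: "\<mu> i \<noteq> 0 \<longleftrightarrow> i < l" for i unfolding l_def by (rule partition_support[OF part])
  have "l \<le> n" using supp[of n] partition_of_bounds(2)[OF \<mu>, of n] by simp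
  \<comment> \<open>The last nonzero part is at least 1, so the initial bound is 0; without nonzero
    parts the series is 1 for any bound.\<close>
  have eq: "rook_series (sum \<mu> {..<l}) l (row_shifts \<mu> l) (max 0 (1 - \<mu> (l - 1))) =
      rook_series (sum \<mu> {..<l}) l (row_shifts \<mu> l) 0"
    using supp[of "l - 1"] by (cases l) (auto simp: rook_series_empty)
  have "{i. \<mu> i \<noteq> 0} = {..<l}" unfolding set_eq_iff mem_Collect_eq lessThan_iff using supp by iprover
  then have "{i. \<mu> i \<noteq> 0} \<subseteq> {..<n}" using \<open>l \<le> n\<close> by simp
  then have "sum \<mu> {..<n} = (\<Sum>i | \<mu> i \<noteq> 0. \<mu> i)" by (intro sum.mono_neutral_right) auto
  also have "\<dots> = n" by (rule sum)
  finally have "sum \<mu> {..<n} = n" .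
  then have "rook_series (sum \<mu> {..<l}) l (row_shifts \<mu> l) 0 = rook_series n n (row_shifts \<mu> n) 0"
  proof -
    have "\<mu> i = 0" if "l \<le> i" for i using supp[of i] that by simp
    then show ?thesis using rook_series_pad[of l \<mu> n, OF _ \<open>l \<le> n\<close>] \<open>sum \<mu> {..<n} = n\<close> by simp
  qed
  then have "part_gf 1 (greedy \<mu> 0 l) = part_gf 1 (\<lambda>_. True) * rook_series n n (row_shifts \<mu> n) 0"
    using part_gf_greedy[OF anti, of 1 0 l] eq by simp
  from this[symmetric] show ?thesis
    unfolding card_partitions_containing[OF part l_def] by (simp add: part_gf_def)
qed

text \<open>The common factor \<open>p\<close> is nonzero, hence cancels, and
  \<open>rook_series_inj\<close> applies.\<close>

lemma wilf_equivalent_iff: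
  assumes \<mu>: "partition_of \<mu> n" and \<nu>: "partition_of \<nu> n"
  shows "wilf_equivalent \<mu> \<nu> \<longleftrightarrow> row_shifts \<mu> n = row_shifts \<nu> n"
proof
  assume "row_shifts \<mu> n = row_shifts \<nu> n"
  then have "of_nat (card (partitions_containing N \<mu>)) =
      (of_nat (card (partitions_containing N \<nu>)) :: rat)" for N
    by (simp add: wilf_gf[OF \<mu>] wilf_gf[OF \<nu>])
  then show "wilf_equivalent \<mu> \<nu>" by (simp add: wilf_equivalent_def)
next
  assume wilf: "wilf_equivalent \<mu> \<nu>"
  show "row_shifts \<mu> n = row_shifts \<nu> n"
  proof (cases "n = 0")
    case False
    define p where "p = part_gf 1 (\<lambda>_. True)"
    define S where "S \<alpha> = rook_series n n (row_shifts \<alpha> n) 0" for \<alpha>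
    have p0: "p $ 0 \<noteq> 0"
    proof -
      have "{xs \<in> part_lists 1 0. True} = {[]}"
      proof (intro set_eqI iffI)
        fix xs assume "xs \<in> {xs \<in> part_lists 1 0. True}"
        then show "xs \<in> {[]}" by (cases xs) (auto simp: part_lists_def)
      qed (simp add: part_lists_def)
      then show ?thesis by (simp add: p_def part_gf_def)
    qed
    \<comment> \<open>Wilf equivalence is silent about \<open>N = 0\<close>; there both series
      vanish, as they start at \<open>q ^ n\<close> with \<open>n > 0\<close>.\<close>
    have S0: "S \<alpha> $ 0 = 0" for \<alpha>
      using False by (simp add: S_def rook_series_def fps_infsum_def rook_term_def)
    have "p * S \<mu> = p * S \<nu>"
    proof (rule fps_ext)
      fix N
      show "(p * S \<mu>) $ N = (p * S \<nu>) $ N"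
      proof (cases "N = 0")
        case False
        then have "card (partitions_containing N \<mu>) = card (partitions_containing N \<nu>)"
          using wilf by (simp add: wilf_equivalent_def)
        then show ?thesis
          using wilf_gf[OF \<mu>, of N] wilf_gf[OF \<nu>, of N] by (simp add: p_def S_def)
      qed (simp add: S0)
    qed
    moreover have "p \<noteq> 0" using p0 by auto
    ultimately have "S \<mu> = S \<nu>" by simp
    then show ?thesis unfolding S_def by (rule rook_series_inj)
  qed simp
qed

theorem theorem3:
  fixes \<mu> \<nu> :: "nat \<Rightarrow> nat" and n :: nat
  assumes "partition_of \<mu> n" and "partition_of \<nu> n"
  shows "rook_equivalent \<mu> \<nu> \<longleftrightarrow> wilf_equivalent \<mu> \<nu>"
  using rook_equivalent_iff[OF assms] wilf_equivalent_iff[OF assms] by simp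

end
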